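(* Let $\beta>0$, $\mathbf{t}=(t_1,t_2)\in\mathbb{R}^2$ with $\mathbf{t}\neq(0,0)$, $|\mathbf{t}|=\sqrt{t_1^2+t_2^2}$, and let $Z$ be the moving maximum process on $\mathbb{R}^2$ generated by the density $\phi(u_1,u_2)=\frac{\beta^2}{2\pi}\exp\{-\beta^2(u_1^2+u_2^2)/2\}$. Let $\Phi$ be the standard normal distribution function. Then for all $w_1,w_2>0$, $$-\log P\{Z(0,0)\le w_1,\ Z(t_1,t_2)\le w_2\}=\frac1{w_1}\Phi\left(\frac{|\mathbf{t}|\beta}{2}+\frac1{|\mathbf{t}|\beta}\log\frac{w_2}{w_1}\right)+\frac1{w_2}\Phi\left(\frac{|\mathbf{t}|\beta}{2}+\frac1{|\mathbf{t}|\beta}\log\frac{w_1}{w_2}\right).$$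
   Context: For a unimodal (nonincreasing in each direction starting from the mode) continuous probability density $\phi$ on $\mathbb{R}^2$, let $\{(X_j,W_j,Y_j)\}_{j\ge1}$ be the points of a homogeneous (unit intensity) Poisson process on $\mathbb{R}^2\times\mathbb{R}_+$. The moving maximum process on $\mathbb{R}^2$ generated by $\phi$ is $$Z(t_1,t_2):=\max_{j\ge1}\frac{\phi(X_j-t_1,W_j-t_2)}{Y_j},\qquad (t_1,t_2)\in\mathbb{R}^2.$$ It is stationary and simple max-stable, and for $\mathbf{t}_i\in\mathbb{R}^2$, $x_i>0$, $$P\{Z(\mathbf{t}_1)\le x_1,\dots,Z(\mathbf{t}_d)\le x_d\}=\exp\left\{-\int_{\mathbb{R}^2}\max_{1\le i\le d}\frac{\phi(\mathbf{s}-\mathbf{t}_i)}{x_i}\,d\mathbf{s}\right\}.$$ *)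

theory Defs
  imports "HOL-Probability.Probability"
begin

definition point_count :: "(nat \<Rightarrow> 'w \<Rightarrow> 'a) \<Rightarrow> 'a set \<Rightarrow> 'w \<Rightarrow> enat" where
  "point_count T A \<omega> =
     (if finite {j. T j \<omega> \<in> A} then enat (card {j. T j \<omega> \<in> A}) else \<infinity>)"

text \<open>
  \<open>T\<close> is a random enumeration of the points of a Poisson process with intensity measure \<open>S\<close>
  on the space of \<open>S\<close>. As \<open>distribution\<close> sums to 1 over \<open>k\<close>, the number of points in
  a set of finite intensity is almost surely finite. The Poisson probabilities are written
  out because \<^const>\<open>poisson_pmf\<close> is specified only for positive rate and \<open>A\<close> may be a null set.
\<close>

locale poisson_points = prob_space M for M :: "'w measure" +
  fixes S :: "'a measure" and T :: "nat \<Rightarrow> 'w \<Rightarrow> 'a"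
  assumes measurable_points: "\<And>j. T j \<in> measurable M S"
    and distribution: "\<And>A k. A \<in> sets S \<Longrightarrow> emeasure S A < \<infinity> \<Longrightarrow>
      prob {\<omega> \<in> space M. point_count T A \<omega> = enat k}
        = measure S A ^ k / fact k * exp (- measure S A)"
    and independence: "\<And>(A :: nat \<Rightarrow> 'a set) n. disjoint_family_on A {..<n} \<Longrightarrow>
      (\<And>i. i < n \<Longrightarrow> A i \<in> sets S \<and> emeasure S (A i) < \<infinity>) \<Longrightarrow>
      indep_vars (\<lambda>_. count_space UNIV) (\<lambda>i. point_count T (A i)) {..<n}"

definition upper_halfspace_lborel :: "(real \<times> real \<times> real) measure" where
  "upper_halfspace_lborel = restrict_space lborel (UNIV \<times> UNIV \<times> {0..})"

text \<open>
  The supremum is taken in \<^typ>\<open>ennreal\<close>, so that it is a genuine supremum for every \<open>\<omega>\<close>,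
  including the null set on which the ratios are unbounded or have no maximum. Division is also
  that of \<^typ>\<open>ennreal\<close>: a point with third coordinate 0 (almost surely there is none) yields
  \<open>\<infinity>\<close> where \<open>\<phi>\<close> is positive, unlike real division by 0.
\<close>

definition moving_maximum ::
  "(real \<Rightarrow> real \<Rightarrow> real) \<Rightarrow> (nat \<Rightarrow> 'w \<Rightarrow> real \<times> real \<times> real) \<Rightarrow> real \<Rightarrow> real \<Rightarrow> 'w \<Rightarrow> ennreal" where
  "moving_maximum \<phi> T t1 t2 \<omega> =
     (SUP j. case T j \<omega> of (x, w, y) \<Rightarrow> ennreal (\<phi> (x - t1) (w - t2)) / ennreal y)"

definition gaussian_density :: "real \<Rightarrow> real \<Rightarrow> real \<Rightarrow> real" where
  "gaussian_density \<beta> u1 u2 = \<beta>\<^sup>2 / (2 * pi) * exp (- (\<beta>\<^sup>2 * (u1\<^sup>2 + u2\<^sup>2) / 2))"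

abbreviation std_normal_cdf :: "real \<Rightarrow> real" where
  "std_normal_cdf \<equiv> cdf std_normal_distribution"

end

theory Submission
  imports Defs
begin

text \<open>
  Both components of the process stay below the thresholds exactly when no Poisson point lies under
  the graph of \<open>m(s) = max (\<phi>(s) / w1) (\<phi>(s - t) / w2)\<close>, so the negative logarithm of the
  probability is the integral of \<open>m\<close>. The two terms of the maximum are separated by the line
  \<open>s \<bullet> t = |t|\<^sup>2 / 2 + ln (w2 / w1) / \<beta>\<^sup>2\<close>. Translating the second term by \<open>t\<close> turns both
  contributions into Gaussian measures of half-planes. Under \<open>\<phi>\<close> the variable \<open>\<beta> s \<bullet> t / |t|\<close>
  is standard normal, by comparison of characteristic functions.
\<close>

section \<open>Measurability of the projections for the Borel sets of a product type\<close>

lemma borel_measurable_fst [measurable (raw)]: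
  fixes f :: "'c \<Rightarrow> 'a::topological_space \<times> 'b::topological_space"
  assumes "f \<in> borel_measurable M"
  shows "(\<lambda>x. fst (f x)) \<in> borel_measurable M"
  by (rule measurable_compose[OF assms]) (intro borel_measurable_continuous_onI continuous_intros)

lemma borel_measurable_snd [measurable (raw)]:
  fixes f :: "'c \<Rightarrow> 'a::topological_space \<times> 'b::topological_space"
  assumes "f \<in> borel_measurable M"
  shows "(\<lambda>x. snd (f x)) \<in> borel_measurable M"
  by (rule measurable_compose[OF assms]) (intro borel_measurable_continuous_onI continuous_intros)

text \<open>Rotation invariance of the planar Gaussian. By Fubini the characteristic function of the
  linear form at \<open>s\<close> is the product of the one-dimensional ones at \<open>s * a\<close>
  and \<open>s * b\<close>. The exponents add up to that at \<open>s\<close> because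
  \<open>(a, b)\<close> is a unit vector.\<close>

lemma distr_linear_std_normal_pair:
  fixes a b :: real
  assumes "a\<^sup>2 + b\<^sup>2 = 1"
  shows "distr (std_normal_distribution \<Otimes>\<^sub>M std_normal_distribution) borel (\<lambda>p. a * fst p + b * snd p)
    = std_normal_distribution" (is "distr ?P _ ?f = ?N")
proof (rule Levy_uniqueness)
  interpret N: real_distribution ?N by (rule real_dist_normal_dist)
  interpret P: pair_prob_space ?N ?N ..
  \<comment> \<open>The factors of \<open>?P\<close> are densities with the Borel sets as their
    sets, so measurability is checked over the product of two copies of
    \<open>borel\<close>.\<close>
  have [measurable]: "?f \<in> borel_measurable ?P"
    by (simp add: measurable_cong_sets[OF sets_pair_measure_cong[of ?N borel ?N borel] refl])
  show "real_distribution (distr ?P borel ?f)"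
    by (rule P.real_distribution_distr) measurable
  show "real_distribution ?N" by (rule N.real_distribution_axioms)
  show "char (distr ?P borel ?f) = char ?N"
  proof
    fix s :: real
    let ?g = "\<lambda>x y. iexp (s * (a * x)) * iexp (s * (b * y))"
    have "char (distr ?P borel ?f) s = (CLINT p|?P. iexp (s * ?f p))"
      unfolding char_def by (subst integral_distr) auto
    also have "\<dots> = (CLINT p|?P. case_prod ?g p)"
      by (intro Bochner_Integration.integral_cong)
        (auto simp: exp_add[symmetric] algebra_simps)
    also have "\<dots> = (CLINT x|?N. CLINT y|?N. ?g x y)"
    proof -
      have "integrable ?P (case_prod ?g)"
        by (rule P.integrable_const_bound[where B=1])
          (auto simp: norm_mult measurable_cong_sets[OF sets_pair_measure_cong[of ?N borel ?N borel] refl])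
      from P.integral_fst'[OF this] show ?thesis by simp
    qed
    also have "\<dots> = (CLINT x|?N. iexp (s * (a * x))) * (CLINT y|?N. iexp (s * (b * y)))"
      by simp
    also have "\<dots> = char ?N (s * a) * char ?N (s * b)"
      by (simp add: char_def mult.assoc)
    also have "\<dots> = char ?N s"
    proof -
      have "(s * a)\<^sup>2 + (s * b)\<^sup>2 = s\<^sup>2"
        using assms by (simp add: power_mult_distrib flip: distrib_left)
      then show ?thesis
        by (simp add: char_std_normal_distribution flip: exp_add of_real_mult add_divide_distrib)
    qed
    finally show "char (distr ?P borel ?f) s = char ?N s" .
  qed
qed

section \<open>Gaussian integrals over preimages of a linear form\<close>

lemma gaussian_density_nonneg [simp]: "0 \<le> gaussian_density \<beta> x y"
  by (simp add: gaussian_density_def)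

lemma gaussian_density_pos: "\<beta> \<noteq> 0 \<Longrightarrow> 0 < gaussian_density \<beta> x y"
  by (simp add: gaussian_density_def)

lemma borel_measurable_gaussian_density [measurable (raw)]:
  assumes [measurable]: "f \<in> borel_measurable M" "g \<in> borel_measurable M"
  shows "(\<lambda>x. gaussian_density \<beta> (f x) (g x)) \<in> borel_measurable M"
  unfolding gaussian_density_def by measurable

text \<open>The divisor \<open>\<beta>\<^sup>2\<close> is the Jacobian of the planar substitution
  dividing both coordinates by \<beta>.\<close>

lemma gaussian_density_scale:
  assumes "\<beta> \<noteq> 0"
  shows "gaussian_density \<beta> (x / \<beta>) (y / \<beta>) / \<beta>\<^sup>2 = std_normal_density x * std_normal_density y"
  using assms
  by (simp add: gaussian_density_def std_normal_density_def power_divide field_simps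
      flip: exp_add real_sqrt_mult)

lemma nn_integral_lborel_scale:
  fixes f :: "'a::euclidean_space \<Rightarrow> ennreal"
  assumes [measurable]: "f \<in> borel_measurable borel" and "c \<noteq> 0"
  shows "(\<integral>\<^sup>+x. f x \<partial>lborel) = (\<integral>\<^sup>+x. ennreal (\<bar>c\<bar> ^ DIM('a)) * f (c *\<^sub>R x) \<partial>lborel)"
  by (subst lborel_affine[OF \<open>c \<noteq> 0\<close>, of 0])
    (simp add: nn_integral_density nn_integral_distr)

lemma nn_integral_lborel_translate:
  fixes f :: "'a::euclidean_space \<Rightarrow> ennreal"
  assumes [measurable]: "f \<in> borel_measurable borel"
  shows "(\<integral>\<^sup>+x. f (c + x) \<partial>lborel) = (\<integral>\<^sup>+x. f x \<partial>lborel)"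
proof -
  have "(\<integral>\<^sup>+x. f x \<partial>distr lborel borel ((+) c)) = (\<integral>\<^sup>+x. f (c + x) \<partial>lborel)"
    by (subst nn_integral_distr) auto
  then show ?thesis by (simp add: lborel_distr_plus)
qed

text \<open>Once the plane is rescaled to standard Gaussian coordinates, the linear form is
  \<open>sqrt (t1\<^sup>2 + t2\<^sup>2) / \<beta>\<close> times a form with unit coefficient vector,
  and the latter is standard normal.\<close>

lemma nn_integral_gaussian_density_linear:
  assumes "\<beta> > 0" "(t1, t2) \<noteq> (0, 0)" and [measurable]: "B \<in> sets borel"
  shows "(\<integral>\<^sup>+p. ennreal (gaussian_density \<beta> (fst p) (snd p))
        * indicator B (t1 * fst p + t2 * snd p) \<partial>lborel)
    = emeasure std_normal_distribution {z. sqrt (t1\<^sup>2 + t2\<^sup>2) / \<beta> * z \<in> B}"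
    (is "?I = emeasure ?N _")
proof -
  define r where "r = sqrt (t1\<^sup>2 + t2\<^sup>2)"
  have r2: "r\<^sup>2 = t1\<^sup>2 + t2\<^sup>2" by (simp add: r_def)
  have "r > 0"
    using assms(2) by (auto simp: r_def sum_power2_gt_zero_iff)
  let ?V = "{z. r / \<beta> * z \<in> B}"
  let ?f = "\<lambda>p. t1 / r * fst p + t2 / r * snd p"
  have V: "?V \<in> sets borel"
    using measurable_sets[of "\<lambda>z. r / \<beta> * z" borel borel B] by (simp add: vimage_def)
  note [measurable] = V
  interpret N: real_distribution ?N by (rule real_dist_normal_dist)
  have "?I = (\<integral>\<^sup>+p. ennreal (std_normal_density (fst p) * std_normal_density (snd p))
        * indicator ?V (?f p) \<partial>(lborel :: (real \<times> real) measure))"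
  proof (subst nn_integral_lborel_scale[of _ "1 / \<beta>"], goal_cases)
    case 1
    show ?case by measurable
  next
    case 2
    show ?case using \<open>\<beta> > 0\<close> by simp
  next
    case 3
    show ?case
    proof (rule nn_integral_cong, goal_cases)
      case (1 p)
      \<comment> \<open>Normalising the coefficients by \<open>r\<close> leaves
        \<open>r / \<beta>\<close>, the standard deviation of the linear form.\<close>
      have "t1 * (fst p / \<beta>) + t2 * (snd p / \<beta>) = r / \<beta> * ?f p"
        using \<open>r > 0\<close> \<open>\<beta> > 0\<close> by (simp add: field_simps)
      then have "indicator B (t1 * (fst p / \<beta>) + t2 * (snd p / \<beta>)) = (indicator ?V (?f p) :: ennreal)"
        by (simp add: indicator_def)
      then show ?case
        using \<open>\<beta> > 0\<close> gaussian_density_scale[of \<beta> "fst p" "snd p", symmetric]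
        by (simp add: power_divide ennreal_mult[symmetric] mult.assoc[symmetric] power2_eq_square)
    qed
  qed
  also have "\<dots> = (\<integral>\<^sup>+p. indicator ?V (?f p)
      \<partial>density (lborel \<Otimes>\<^sub>M lborel) (\<lambda>(x, y). ennreal (std_normal_density x) * ennreal (std_normal_density y)))"
    by (subst nn_integral_density)
      (auto simp: lborel_prod ennreal_mult split_beta intro!: nn_integral_cong)
  also have "density (lborel \<Otimes>\<^sub>M lborel) (\<lambda>(x, y). ennreal (std_normal_density x) * ennreal (std_normal_density y))
      = ?N \<Otimes>\<^sub>M ?N"
    by (rule pair_measure_density[symmetric])
      (auto intro: sigma_finite_lborel N.sigma_finite_measure_axioms)
  also have "(\<integral>\<^sup>+p. indicator ?V (?f p) \<partial>(?N \<Otimes>\<^sub>M ?N))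
      = (\<integral>\<^sup>+z. indicator ?V z \<partial>distr (?N \<Otimes>\<^sub>M ?N) borel ?f)"
    by (subst nn_integral_distr)
      (auto simp: measurable_cong_sets[OF sets_pair_measure_cong[of ?N borel ?N borel] refl])
  also have "\<dots> = emeasure ?N ?V"
    using \<open>r > 0\<close> r2
    by (subst distr_linear_std_normal_pair) (auto simp: power_divide simp flip: add_divide_distrib)
  finally show ?thesis by (simp add: r_def)
qed

section \<open>Half-planes on which one weighted Gaussian density dominates the other\<close>

lemma emeasure_std_normal_atMost: "emeasure std_normal_distribution {..c} = ennreal (std_normal_cdf c)"
proof -
  interpret N: real_distribution std_normal_distribution by (rule real_dist_normal_dist)
  show ?thesis by (simp add: cdf_def N.emeasure_eq_measure)
qed

text \<open>The endpoint is Lebesgue null and the distribution has a density, so open and closed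
  half-lines have equal mass.\<close>

lemma emeasure_std_normal_lessThan: "emeasure std_normal_distribution {..<c} = ennreal (std_normal_cdf c)"
proof -
  have "emeasure std_normal_distribution {..<c} = emeasure std_normal_distribution {..c}"
    using AE_lborel_singleton[of c]
    by (intro emeasure_eq_AE) (auto simp: AE_density)
  then show ?thesis by (simp add: emeasure_std_normal_atMost)
qed

text \<open>After taking logarithms the quadratic terms in \<open>x\<close> and \<open>y\<close>
  cancel, so the comparison is an affine inequality.\<close>

lemma gaussian_density_shift_le_iff:
  assumes "\<beta> > 0" "v > 0" "w > 0"
  shows "gaussian_density \<beta> (x - s1) (y - s2) / w \<le> gaussian_density \<beta> x y / v
    \<longleftrightarrow> s1 * x + s2 * y \<le> (s1\<^sup>2 + s2\<^sup>2) / 2 + ln (w / v) / \<beta>\<^sup>2"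
proof -
  let ?E = "\<lambda>x y. - (\<beta>\<^sup>2 * (x\<^sup>2 + y\<^sup>2) / 2)"
  have "gaussian_density \<beta> (x - s1) (y - s2) / w \<le> gaussian_density \<beta> x y / v
      \<longleftrightarrow> ln (gaussian_density \<beta> (x - s1) (y - s2) / w) \<le> ln (gaussian_density \<beta> x y / v)"
    using assms by (subst ln_le_cancel_iff) (auto intro!: divide_pos_pos gaussian_density_pos)
  also have "\<dots> \<longleftrightarrow> ?E (x - s1) (y - s2) - ln w \<le> ?E x y - ln v"
    using assms by (simp add: ln_div ln_mult gaussian_density_def)
  also have "\<dots> \<longleftrightarrow> \<beta>\<^sup>2 * (s1 * x + s2 * y) \<le> \<beta>\<^sup>2 * ((s1\<^sup>2 + s2\<^sup>2) / 2) + ln (w / v)"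
    using assms
    by (auto simp: ln_div power2_eq_square distrib_left right_diff_distrib left_diff_distrib
        add_divide_distrib diff_divide_distrib mult_ac)
  also have "\<dots> \<longleftrightarrow> \<beta>\<^sup>2 * (s1 * x + s2 * y) \<le> \<beta>\<^sup>2 * ((s1\<^sup>2 + s2\<^sup>2) / 2 + ln (w / v) / \<beta>\<^sup>2)"
    using assms by (simp add: distrib_left)
  also have "\<dots> \<longleftrightarrow> s1 * x + s2 * y \<le> (s1\<^sup>2 + s2\<^sup>2) / 2 + ln (w / v) / \<beta>\<^sup>2"
    using assms by simp
  finally show ?thesis .
qed

text \<open>This negates the non-strict comparison with the two densities exchanged: it is read at
  the point shifted by \<open>(- s1, - s2)\<close>, with the shift reversed and the weights
  \<open>v\<close> and \<open>w\<close> swapped.\<close>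

lemma gaussian_density_shift_less_iff:
  assumes "\<beta> > 0" "v > 0" "w > 0"
  shows "gaussian_density \<beta> (x - s1) (y - s2) / w < gaussian_density \<beta> x y / v
    \<longleftrightarrow> s1 * x + s2 * y < (s1\<^sup>2 + s2\<^sup>2) / 2 + ln (w / v) / \<beta>\<^sup>2"
proof -
  have "(- s1) * (x - s1) + (- s2) * (y - s2) \<le> ((- s1)\<^sup>2 + (- s2)\<^sup>2) / 2 + ln (v / w) / \<beta>\<^sup>2
    \<longleftrightarrow> (s1\<^sup>2 + s2\<^sup>2) / 2 + ln (w / v) / \<beta>\<^sup>2 \<le> s1 * x + s2 * y"
    using assms by (simp add: ln_div power2_eq_square field_simps)
  then show ?thesis
    using gaussian_density_shift_le_iff[of \<beta> w v "x - s1" "- s1" "y - s2" "- s2"] assms by auto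
qed

text \<open>Both versions serve the integral of the maximum: one density takes the closed half-plane
  and the other the open one, so the line of ties is counted once.\<close>

lemma
  fixes \<beta> s1 s2 v w :: real
  assumes "\<beta> > 0" "(s1, s2) \<noteq> (0, 0)" "v > 0" "w > 0"
  defines "r \<equiv> sqrt (s1\<^sup>2 + s2\<^sup>2)"
  shows nn_integral_gaussian_density_dominating:
    "(\<integral>\<^sup>+p. ennreal (gaussian_density \<beta> (fst p) (snd p) / v)
        * indicator {p. gaussian_density \<beta> (fst p - s1) (snd p - s2) / w
            \<le> gaussian_density \<beta> (fst p) (snd p) / v} p \<partial>lborel)
      = ennreal (1 / v * std_normal_cdf (r * \<beta> / 2 + 1 / (r * \<beta>) * ln (w / v)))" (is "?I = ?R")
  and nn_integral_gaussian_density_strictly_dominating: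
    "(\<integral>\<^sup>+p. ennreal (gaussian_density \<beta> (fst p) (snd p) / v)
        * indicator {p. gaussian_density \<beta> (fst p - s1) (snd p - s2) / w
            < gaussian_density \<beta> (fst p) (snd p) / v} p \<partial>lborel)
      = ennreal (1 / v * std_normal_cdf (r * \<beta> / 2 + 1 / (r * \<beta>) * ln (w / v)))" (is "?J = ?R")
proof -
  let ?c = "(s1\<^sup>2 + s2\<^sup>2) / 2 + ln (w / v) / \<beta>\<^sup>2"
  let ?d = "r * \<beta> / 2 + 1 / (r * \<beta>) * ln (w / v)"
  let ?N = std_normal_distribution
  have r2: "s1\<^sup>2 + s2\<^sup>2 = r\<^sup>2" by (simp add: r_def)
  have "r > 0"
    using assms(2) by (auto simp: r_def sum_power2_gt_zero_iff)
  \<comment> \<open>Dividing the threshold by the standard deviation \<open>r / \<beta>\<close>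
    produces the argument of the normal distribution function.\<close>
  then have c: "?c = r / \<beta> * ?d"
    using \<open>\<beta> > 0\<close> unfolding r2 by (simp add: field_simps power2_eq_square)
  have pos: "r / \<beta> > 0" using \<open>r > 0\<close> \<open>\<beta> > 0\<close> by simp
  \<comment> \<open>The set \<open>B\<close> stays general so that it can be the closed or the open
    half-line below \<open>?c\<close>.\<close>
  have reduce: "(\<integral>\<^sup>+p. ennreal (gaussian_density \<beta> (fst p) (snd p) / v) * indicator A p \<partial>lborel)
      = ennreal (1 / v) * emeasure ?N {z. r / \<beta> * z \<in> B}"
    if A: "A = {p. s1 * fst p + s2 * snd p \<in> B}" and [measurable]: "B \<in> sets borel" for A B
  proof -
    have "(\<integral>\<^sup>+p. ennreal (gaussian_density \<beta> (fst p) (snd p) / v) * indicator A p \<partial>lborel)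
      = (\<integral>\<^sup>+p. ennreal (1 / v) * (ennreal (gaussian_density \<beta> (fst p) (snd p))
          * indicator B (s1 * fst p + s2 * snd p)) \<partial>lborel)"
      using \<open>v > 0\<close>
      by (intro nn_integral_cong)
        (auto simp: A indicator_def mult.assoc[symmetric] ennreal_mult[symmetric])
    also have "\<dots> = ennreal (1 / v) * (\<integral>\<^sup>+p. ennreal (gaussian_density \<beta> (fst p) (snd p))
          * indicator B (s1 * fst p + s2 * snd p) \<partial>lborel)"
      by (rule nn_integral_cmult) measurable
    also have "\<dots> = ennreal (1 / v) * emeasure ?N {z. r / \<beta> * z \<in> B}"
      using assms by (subst nn_integral_gaussian_density_linear) (auto simp: r_def)
    finally show ?thesis .
  qed
  have R: "ennreal (1 / v) * ennreal (std_normal_cdf ?d) = ?R"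
    using \<open>v > 0\<close> by (simp add: ennreal_mult[symmetric] cdf_def)
  have "{z. r / \<beta> * z \<in> {..?c}} = {..?d}"
    unfolding c using pos by (auto simp only: atMost_iff mult_le_cancel_left_pos)
  then have "ennreal (1 / v) * emeasure ?N {z. r / \<beta> * z \<in> {..?c}} = ?R"
    by (simp only: emeasure_std_normal_atMost R)
  moreover have "?I = ennreal (1 / v) * emeasure ?N {z. r / \<beta> * z \<in> {..?c}}"
    using assms(1-4) by (intro reduce) (auto simp: gaussian_density_shift_le_iff)
  ultimately show "?I = ?R" by simp
  have "{z. r / \<beta> * z \<in> {..<?c}} = {..<?d}"
    unfolding c using pos by (auto simp only: lessThan_iff mult_less_cancel_left_pos)
  then have "ennreal (1 / v) * emeasure ?N {z. r / \<beta> * z \<in> {..<?c}} = ?R"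
    by (simp only: emeasure_std_normal_lessThan R)
  moreover have "?J = ennreal (1 / v) * emeasure ?N {z. r / \<beta> * z \<in> {..<?c}}"
    using assms(1-4) by (intro reduce) (auto simp: gaussian_density_shift_less_iff)
  ultimately show "?J = ?R" by simp
qed

lemma nn_integral_max_gaussian_density:
  assumes "\<beta> > 0" "(t1, t2) \<noteq> (0, 0)" "v > 0" "w > 0"
  defines "r \<equiv> sqrt (t1\<^sup>2 + t2\<^sup>2)"
  shows "(\<integral>\<^sup>+p. ennreal (max (gaussian_density \<beta> (fst p) (snd p) / v)
          (gaussian_density \<beta> (fst p - t1) (snd p - t2) / w)) \<partial>lborel)
    = ennreal (1 / v * std_normal_cdf (r * \<beta> / 2 + 1 / (r * \<beta>) * ln (w / v))
        + 1 / w * std_normal_cdf (r * \<beta> / 2 + 1 / (r * \<beta>) * ln (v / w)))"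
proof -
  let ?g = "\<lambda>p. gaussian_density \<beta> (fst p) (snd p) / v"
  let ?h = "\<lambda>p. gaussian_density \<beta> (fst p - t1) (snd p - t2) / w"
  \<comment> \<open>Strictness leaves ties to \<open>?g\<close>, which makes the splitting of the
    maximum a pointwise identity.\<close>
  let ?k = "\<lambda>p. ennreal (?h p) * indicator {p. ?g p < ?h p} p"
  have "(\<integral>\<^sup>+p. ennreal (max (?g p) (?h p)) \<partial>lborel)
      = (\<integral>\<^sup>+p. ennreal (?g p) * indicator {p. ?h p \<le> ?g p} p + ?k p \<partial>lborel)"
    by (intro nn_integral_cong) (auto simp: max_def indicator_def)
  also have "\<dots> = (\<integral>\<^sup>+p. ennreal (?g p) * indicator {p. ?h p \<le> ?g p} p \<partial>lborel) + (\<integral>\<^sup>+p. ?k p \<partial>lborel)"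
    by (rule nn_integral_add) measurable
  \<comment> \<open>Translation by \<open>(t1, t2)\<close> centres the second density at the origin
    and moves the first to \<open>(- t1, - t2)\<close>. The half-plane formula then applies with the
    same \<open>r\<close> and exchanged weights.\<close>
  also have "(\<integral>\<^sup>+p. ?k p \<partial>lborel) = (\<integral>\<^sup>+p. ?k ((t1, t2) + p) \<partial>lborel)"
    by (rule nn_integral_lborel_translate[symmetric]) measurable
  also have "\<dots> = (\<integral>\<^sup>+p. ennreal (gaussian_density \<beta> (fst p) (snd p) / w)
        * indicator {p. gaussian_density \<beta> (fst p - (- t1)) (snd p - (- t2)) / v
            < gaussian_density \<beta> (fst p) (snd p) / w} p \<partial>lborel)"
    by (intro nn_integral_cong) (auto simp: indicator_def add.commute)
  also have "\<dots> = ennreal (1 / w * std_normal_cdf (r * \<beta> / 2 + 1 / (r * \<beta>) * ln (v / w)))"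
    using assms by (subst nn_integral_gaussian_density_strictly_dominating) auto
  also have "(\<integral>\<^sup>+p. ennreal (?g p) * indicator {p. ?h p \<le> ?g p} p \<partial>lborel)
      = ennreal (1 / v * std_normal_cdf (r * \<beta> / 2 + 1 / (r * \<beta>) * ln (w / v)))"
    using assms by (subst nn_integral_gaussian_density_dominating) auto
  finally show ?thesis
    using assms by (simp add: cdf_def)
qed

section \<open>From Poisson points to the integral of the maximum\<close>

lemma emeasure_lborel_hypograph:
  fixes f :: "real \<Rightarrow> real \<Rightarrow> real"
  assumes [measurable]: "(\<lambda>p. f (fst p) (snd p)) \<in> borel_measurable borel"
    and "\<And>x w. 0 \<le> f x w"
  shows "emeasure lborel {(x, w, y). 0 \<le> y \<and> y < f x w}
    = (\<integral>\<^sup>+p. ennreal (f (fst p) (snd p)) \<partial>lborel)"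
proof -
  let ?A = "{(x, w, y). 0 \<le> y \<and> y < f x w}"
  have [measurable]: "(\<lambda>p. f (fst p) (fst (snd p))) \<in> borel_measurable (borel :: (real \<times> real \<times> real) measure)"
    using measurable_compose[OF _ assms(1), of "\<lambda>p. (fst p, fst (snd p))" borel] by simp
  have A [measurable]: "?A \<in> sets borel"
  proof -
    have "?A = {p \<in> space borel. 0 \<le> snd (snd p) \<and> snd (snd p) < f (fst p) (fst (snd p))}"
      by auto
    also have "\<dots> \<in> sets borel" by measurable
    finally show ?thesis .
  qed
  have [measurable]: "case_prod f \<in> borel_measurable (lborel \<Otimes>\<^sub>M lborel)"
    using assms(1) by (simp add: lborel_prod split_beta')
  \<comment> \<open>Tonelli is applied twice, slicing in \<open>x\<close> and then in
    \<open>w\<close>. The remaining section is \<open>{0..<f x w}\<close>, of length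
    \<open>f x w\<close>.\<close>
  have "emeasure lborel ?A = (\<integral>\<^sup>+x. emeasure lborel (Pair x -` ?A) \<partial>lborel)"
    by (subst lborel_prod[symmetric], rule lborel.emeasure_pair_measure_alt) (simp only: lborel_prod sets_lborel A)
  also have "\<dots> = (\<integral>\<^sup>+x. \<integral>\<^sup>+w. ennreal (f x w) \<partial>lborel \<partial>lborel)"
  proof (rule nn_integral_cong, goal_cases)
    case (1 x)
    have "Pair x -` ?A \<in> sets (lborel \<Otimes>\<^sub>M lborel)"
      by (rule sets_Pair1[of _ lborel]) (simp only: lborel_prod sets_lborel A)
    moreover have "Pair w -` Pair x -` ?A = {0..<f x w}" for w by auto
    ultimately show ?case
      by (subst lborel_prod[symmetric], subst lborel.emeasure_pair_measure_alt)
        (auto simp: assms(2))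
  qed
  also have "\<dots> = (\<integral>\<^sup>+p. ennreal (f (fst p) (snd p)) \<partial>(lborel \<Otimes>\<^sub>M lborel))"
    by (subst lborel.nn_integral_fst[symmetric]) (auto simp: lborel_prod)
  finally show ?thesis by (simp add: lborel_prod)
qed

lemma (in poisson_points) void_probability:
  assumes "A \<in> sets S" "emeasure S A < \<infinity>"
  shows "prob {\<omega> \<in> space M. \<forall>j. T j \<omega> \<notin> A} = exp (- measure S A)"
proof -
  \<comment> \<open>An infinite index set has count \<infinity>, so count zero really means that no
    point is hit, and the void probability is the case \<open>k = 0\<close> of the Poisson
    law.\<close>
  have "point_count T A \<omega> = enat 0 \<longleftrightarrow> (\<forall>j. T j \<omega> \<notin> A)" for \<omega>
    by (auto simp: point_count_def intro: not_finite_existsD)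
  then show ?thesis using distribution[OF assms, of 0] by simp
qed

text \<open>At \<open>y = 0\<close> both sides are false: the extended quotient is \<infinity>
  because \<open>a\<close> is positive, and \<open>a / w\<close> exceeds 0.\<close>

lemma ennreal_divide_le_iff:
  fixes a y w :: real
  assumes "0 < a" "0 \<le> y" "0 < w"
  shows "ennreal a / ennreal y \<le> ennreal w \<longleftrightarrow> a / w \<le> y"
proof (cases "y = 0")
  case True
  then show ?thesis using assms by (simp add: ennreal_divide_eq_top_iff top_unique not_le)
next
  case False
  then show ?thesis using assms by (simp add: divide_ennreal field_simps)
qed

theorem proposition2p5:
  fixes M :: "'w measure"
    and T :: "nat \<Rightarrow> 'w \<Rightarrow> real \<times> real \<times> real"
    and Z :: "real \<Rightarrow> real \<Rightarrow> 'w \<Rightarrow> ennreal"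
    and \<beta> t1 t2 abs_t w1 w2 :: real
  assumes "poisson_points M upper_halfspace_lborel T"
    and "\<beta> > 0"
    and "(t1, t2) \<noteq> (0, 0)"
    and "abs_t = sqrt (t1\<^sup>2 + t2\<^sup>2)"
    and "Z = moving_maximum (gaussian_density \<beta>) T"
    and "w1 > 0" and "w2 > 0"
  shows "- ln (measure M {\<omega> \<in> space M. Z 0 0 \<omega> \<le> ennreal w1 \<and> Z t1 t2 \<omega> \<le> ennreal w2})
    = 1 / w1 * std_normal_cdf (abs_t * \<beta> / 2 + 1 / (abs_t * \<beta>) * ln (w2 / w1))
    + 1 / w2 * std_normal_cdf (abs_t * \<beta> / 2 + 1 / (abs_t * \<beta>) * ln (w1 / w2))"
proof -
  interpret poisson_points M upper_halfspace_lborel T by fact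
  let ?S = "upper_halfspace_lborel"
  let ?g = "\<lambda>x w. gaussian_density \<beta> x w / w1"
  let ?h = "\<lambda>x w. gaussian_density \<beta> (x - t1) (w - t2) / w2"
  \<comment> \<open>The forbidden region: a point violates one of the two thresholds exactly when
    its height \<open>y\<close> lies below the larger of the weighted densities.\<close>
  let ?A = "{(x, w, y). 0 \<le> y \<and> y < max (?g x w) (?h x w)}"
  let ?R = "1 / w1 * std_normal_cdf (abs_t * \<beta> / 2 + 1 / (abs_t * \<beta>) * ln (w2 / w1))
    + 1 / w2 * std_normal_cdf (abs_t * \<beta> / 2 + 1 / (abs_t * \<beta>) * ln (w1 / w2))"
  have em: "emeasure lborel ?A = ennreal ?R"
    using assms by (subst emeasure_lborel_hypograph) (auto simp: nn_integral_max_gaussian_density le_max_iff_disj)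
  have A: "?A \<in> sets lborel"
  proof -
    have "?A = {p \<in> space borel. 0 \<le> snd (snd p) \<and>
        snd (snd p) < max (?g (fst p) (fst (snd p))) (?h (fst p) (fst (snd p)))}"
      by auto
    also have "\<dots> \<in> sets borel" by measurable
    finally show ?thesis by simp
  qed
  \<comment> \<open>The half-space is measurable, so restricting \<open>lborel\<close> to it does
    not change the measure of \<open>?A\<close>.\<close>
  have half: "UNIV \<times> UNIV \<times> {0..} \<inter> space lborel \<in> sets (lborel :: (real \<times> real \<times> real) measure)"
    by (auto intro!: borel_closed closed_Times)
  have sub: "?A \<subseteq> UNIV \<times> UNIV \<times> {0..}" by auto
  have SA: "?A \<in> sets ?S"
    using A sub half by (simp add: upper_halfspace_lborel_def sets_restrict_space_iff)
  have emS: "emeasure ?S ?A = ennreal ?R"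
    using sub half em by (simp add: upper_halfspace_lborel_def emeasure_restrict_space)
  \<comment> \<open>Nonnegativity allows the passage from \<open>ennreal ?R\<close> back to the real
    value \<open>?R\<close>.\<close>
  have "?R \<ge> 0" using assms by (simp add: cdf_def)
  have "{\<omega> \<in> space M. Z 0 0 \<omega> \<le> ennreal w1 \<and> Z t1 t2 \<omega> \<le> ennreal w2}
      = {\<omega> \<in> space M. \<forall>j. T j \<omega> \<notin> ?A}"
  proof (rule Collect_cong, rule conj_cong[OF refl])
    fix \<omega> assume \<omega>: "\<omega> \<in> space M"
    have *: "(case T j \<omega> of (x, w, y) \<Rightarrow> ennreal (gaussian_density \<beta> (x - 0) (w - 0)) / ennreal y) \<le> ennreal w1
        \<and> (case T j \<omega> of (x, w, y) \<Rightarrow> ennreal (gaussian_density \<beta> (x - t1) (w - t2)) / ennreal y) \<le> ennreal w2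
      \<longleftrightarrow> T j \<omega> \<notin> ?A" for j
    proof -
      obtain x w y where T: "T j \<omega> = (x, w, y)" by (cases "T j \<omega>")
      \<comment> \<open>Points lie in the half-space for every outcome. The sign of \<open>y\<close>
        matters because \<open>ennreal\<close> sends negative reals to 0.\<close>
      have "T j \<omega> \<in> space ?S" using measurable_space[OF measurable_points \<omega>] .
      then have "y \<ge> 0" by (simp add: T upper_halfspace_lborel_def space_restrict_space)
      then show ?thesis
        using assms by (auto simp: T ennreal_divide_le_iff gaussian_density_pos not_less)
    qed
    show "(Z 0 0 \<omega> \<le> ennreal w1 \<and> Z t1 t2 \<omega> \<le> ennreal w2) \<longleftrightarrow> (\<forall>j. T j \<omega> \<notin> ?A)"
      \<comment> \<open>A supremum is at most a threshold iff every term is, whether or not it is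
        attained.\<close>
      unfolding assms(5) moving_maximum_def SUP_le_iff ball_UNIV all_conj_distrib[symmetric] * ..
  qed
  then have "prob {\<omega> \<in> space M. Z 0 0 \<omega> \<le> ennreal w1 \<and> Z t1 t2 \<omega> \<le> ennreal w2} = exp (- measure ?S ?A)"
    using void_probability[OF SA] emS by simp
  also have "measure ?S ?A = ?R"
    using emS \<open>?R \<ge> 0\<close> by (simp add: measure_def)
  finally show ?thesis by simp
qed

end
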